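(* Let $m>2$ be an integer. There exist a vector $\theta\in\mathbb{R}^m$ which is non-singular and a vector $\eta\in\mathbb{R}^m$ such that for every $(t_3,\dots,t_m)\in\mathbb{R}^{m-2}$, $$\inf_{q\in\mathbb{Z}\smallsetminus\{0\}} |q|^{1/m}\,\langle q\theta-(\eta+t_3\mathbf{e}_3+\dots+t_m\mathbf{e}_m)\rangle>0 .$$ In particular $\operatorname{Bad}_\theta$ contains a coset of a subtorus of $\mathbb{T}^m$ of codimension $2$, and consequently there are non-trivial algebraic measures $\mu$ on $\mathbb{T}^m$ with $\mu(\operatorname{Bad}_\theta)=1$.
   Context: Fix a norm $\|\cdot\|$ on $\mathbb{R}^m$ and let $\langle z\rangle=\min_{p\in\mathbb{Z}^m}\|z-p\|$ denote the induced distance to the integers (equivalently the distance to $0$ on $\mathbb{T}^m=\mathbb{R}^m/\mathbb{Z}^m$). $\mathbf{e}_3,\dots,\mathbf{e}_m$ are the last $m-2$ standard basis vectors of $\mathbb{R}^m$. A column vector $\theta\in\mathbb{R}^m$ (viewed as an $m\times 1$ matrix) is singular if for every $\varepsilon>0$ and all sufficiently large $Q$, $Q^{1/m}\min\{\langle q\theta\rangle: q\in\mathbb{Z}\smallsetminus\{0\},\ |q|\le Q\}<\varepsilon$; non-singular otherwise. $\operatorname{Bad}_\theta=\{\eta\in\mathbb{T}^m: \liminf_{|q|\to\infty,\,q\in\mathbb{Z}}|q|^{1/m}\langle q\theta-\eta\rangle>0\}$. A probability measure $\mu$ on $\mathbb{T}^m$ is algebraic if there is a subspace $U\le\mathbb{R}^m$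 with $U\cap\mathbb{Z}^m$ a lattice in $U$ such that $\mu$ is the $U$-invariant probability measure supported on a single $U$-orbit in $\mathbb{T}^m$; it is non-trivial if $U\neq\{0\}$. *)

theory Defs
  imports "HOL-Probability.Probability_Measure"
begin

definition is_norm :: "('a::real_vector \<Rightarrow> real) \<Rightarrow> bool" where
  "is_norm N \<longleftrightarrow>
     (\<forall>x. N x \<ge> 0) \<and>
     (\<forall>x. N x = 0 \<longleftrightarrow> x = 0) \<and>
     (\<forall>c x. N (c *\<^sub>R x) = \<bar>c\<bar> * N x) \<and>
     (\<forall>x y. N (x + y) \<le> N x + N y)"

definition int_vecs :: "(real ^ 'm) set" where
  "int_vecs = {p. \<forall>i. p $ i \<in> \<int>}"

lemma int_vecs_0 [simp]: "0 \<in> int_vecs"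
  by (simp add: int_vecs_def)

lemma int_vecs_add: "x \<in> int_vecs \<Longrightarrow> y \<in> int_vecs \<Longrightarrow> x + y \<in> int_vecs"
  by (simp add: int_vecs_def)

lemma int_vecs_minus: "x \<in> int_vecs \<Longrightarrow> - x \<in> int_vecs"
  by (simp add: int_vecs_def)

lemma int_vecs_diff: "x \<in> int_vecs \<Longrightarrow> y \<in> int_vecs \<Longrightarrow> x - y \<in> int_vecs"
  by (simp add: int_vecs_def)

text \<open>The infimum is over the values of a norm on a translate of the integer lattice, so it is
  attained when \<open>N\<close> is a norm.\<close>

definition dist_int :: "(real ^ 'm \<Rightarrow> real) \<Rightarrow> real ^ 'm \<Rightarrow> real" where
  "dist_int N z = (INF p\<in>int_vecs. N (z - p))"

lemma dist_int_cong_int_vecs: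
  fixes N :: "real ^ 'm \<Rightarrow> real"
  assumes "x - y \<in> int_vecs"
  shows "dist_int N x = dist_int N y"
proof -
  have *: "(\<lambda>p. N (a - p)) ` int_vecs \<subseteq> (\<lambda>p. N (b - p)) ` int_vecs"
    if "a - b \<in> int_vecs" for a b
  proof
    fix r assume "r \<in> (\<lambda>p. N (a - p)) ` int_vecs"
    then obtain p where p: "p \<in> int_vecs" "r = N (a - p)" by blast
    have "r = N (b - (p - (a - b)))" using p by simp
    then show "r \<in> (\<lambda>p. N (b - p)) ` int_vecs"
      using int_vecs_diff[OF p(1) that] by blast
  qed
  have "y - x \<in> int_vecs" using int_vecs_minus[OF assms] by simp
  then have "(\<lambda>p. N (x - p)) ` int_vecs = (\<lambda>p. N (y - p)) ` int_vecs"
    using *[OF assms] *[of y x] by (intro subset_antisym)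
  then show ?thesis
    unfolding dist_int_def by (rule arg_cong)
qed

quotient_type 'm torus = "real ^ ('m::finite)" / "\<lambda>x y. x - y \<in> int_vecs"
  morphisms rep_torus to_torus
proof (rule equivpI)
  show "reflp (\<lambda>x y :: real ^ 'm. x - y \<in> int_vecs)"
    by (simp add: reflp_def)
  show "symp (\<lambda>x y :: real ^ 'm. x - y \<in> int_vecs)"
    by (rule sympI) (drule int_vecs_minus, simp)
  show "transp (\<lambda>x y :: real ^ 'm. x - y \<in> int_vecs)"
  proof (rule transpI)
    fix x y z :: "real ^ 'm"
    assume "x - y \<in> int_vecs" "y - z \<in> int_vecs"
    from int_vecs_add[OF this] show "x - z \<in> int_vecs" by simp
  qed
qed

instantiation torus :: (finite) ab_group_add
begin

lift_definition zero_torus :: "'a torus" is 0 .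

lift_definition plus_torus :: "'a torus \<Rightarrow> 'a torus \<Rightarrow> 'a torus" is "(+)"
proof -
  fix a b c d :: "real ^ 'a"
  assume "a - b \<in> int_vecs" "c - d \<in> int_vecs"
  from int_vecs_add[OF this] show "a + c - (b + d) \<in> int_vecs"
    by (simp add: algebra_simps)
qed

lift_definition minus_torus :: "'a torus \<Rightarrow> 'a torus \<Rightarrow> 'a torus" is "(-)"
proof -
  fix a b c d :: "real ^ 'a"
  assume "a - b \<in> int_vecs" "c - d \<in> int_vecs"
  from int_vecs_diff[OF this] show "a - c - (b - d) \<in> int_vecs"
    by (simp add: algebra_simps)
qed

lift_definition uminus_torus :: "'a torus \<Rightarrow> 'a torus" is uminus
proof -
  fix a b :: "real ^ 'a"
  assume "a - b \<in> int_vecs"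
  from int_vecs_minus[OF this] show "- a - - b \<in> int_vecs"
    by (simp add: algebra_simps)
qed

instance
proof
  fix a b c :: "'a torus"
  show "a + b + c = a + (b + c)" by transfer (simp add: add.assoc)
  show "a + b = b + a" by transfer (simp add: add.commute)
  show "0 + a = a" by transfer simp
  show "- a + a = 0" by transfer simp
  show "a - b = a + - b" by transfer simp
qed

end

text \<open>The quotient topology; \<open>borel :: 'm torus measure\<close> is then the Borel sigma-algebra of the
  torus.\<close>

instantiation torus :: (finite) topological_space
begin

definition open_torus :: "'a torus set \<Rightarrow> bool" where
  "open_torus S \<longleftrightarrow> open (to_torus -` S)"

instance
  by standard (auto simp: open_torus_def vimage_Union)

end

lift_definition torus_dist0 :: "(real ^ 'm \<Rightarrow> real) \<Rightarrow> 'm::finite torus \<Rightarrow> real" is dist_int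
  by (rule dist_int_cong_int_vecs)

definition singular :: "(real ^ 'm \<Rightarrow> real) \<Rightarrow> real ^ 'm \<Rightarrow> bool" where
  "singular N \<theta> \<longleftrightarrow>
     (\<forall>\<epsilon>>0. \<forall>\<^sub>F Q :: real in at_top.
        Q powr (1 / CARD('m)) *
          Min ((\<lambda>q. dist_int N (real_of_int q *\<^sub>R \<theta>)) ` {q :: int. q \<noteq> 0 \<and> real_of_int \<bar>q\<bar> \<le> Q}) < \<epsilon>)"

definition Bad :: "(real ^ 'm \<Rightarrow> real) \<Rightarrow> real ^ 'm \<Rightarrow> 'm torus set" where
  "Bad N \<theta> =
     {\<eta>. 0 < Liminf (filtercomap (\<lambda>q :: int. \<bar>q\<bar>) at_top)
            (\<lambda>q. ereal (real_of_int \<bar>q\<bar> powr (1 / CARD('m)) *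
                          torus_dist0 N (to_torus (real_of_int q *\<^sub>R \<theta>) - \<eta>)))}"

text \<open>\<open>L\<close> is a discrete additive subgroup of \<open>U\<close> that spans it; inclusion in \<open>U\<close> follows from
  the last conjunct.\<close>

definition lattice_in :: "'a::euclidean_space set \<Rightarrow> 'a set \<Rightarrow> bool" where
  "lattice_in L U \<longleftrightarrow>
     0 \<in> L \<and> (\<forall>x\<in>L. \<forall>y\<in>L. x - y \<in> L) \<and> discrete L \<and> span L = U"

text \<open>A subtorus is the image in the torus of a rational subspace, the latter being a subspace in
  which the integer vectors form a lattice; its dimension is that of the subspace.\<close>

definition rational_subspace :: "(real ^ 'm) set \<Rightarrow> bool" where
  "rational_subspace U \<longleftrightarrow> subspace U \<and> lattice_in (U \<inter> int_vecs) U"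

definition subtorus_codim :: "nat \<Rightarrow> 'm::finite torus set \<Rightarrow> bool" where
  "subtorus_codim k S \<longleftrightarrow>
     (\<exists>U :: (real ^ 'm) set. rational_subspace U \<and> dim U + k = CARD('m) \<and> S = to_torus ` U)"

text \<open>The orbit of a rational subspace is closed, so in the last conjunct it is a Borel set and full
  measure means that the measure is supported on it.\<close>

definition algebraic_wrt :: "(real ^ 'm) set \<Rightarrow> 'm::finite torus measure \<Rightarrow> bool" where
  "algebraic_wrt U \<mu> \<longleftrightarrow>
     rational_subspace U \<and>
     sets \<mu> = sets borel \<and> prob_space \<mu> \<and>
     (\<forall>u\<in>U. distr \<mu> borel (\<lambda>z. z + to_torus u) = \<mu>) \<and>
     (\<exists>x. emeasure \<mu> ((\<lambda>u. x + to_torus u) ` U) = 1)"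

definition nontrivial_algebraic :: "'m::finite torus measure \<Rightarrow> bool" where
  "nontrivial_algebraic \<mu> \<longleftrightarrow> (\<exists>U. U \<noteq> {0} \<and> algebraic_wrt U \<mu>)"

end

theory Submission
  imports Defs "HOL-Computational_Algebra.Primes"
begin

text \<open>
  The vector \<open>\<theta>\<close> is a limit of rational vectors attached to rapidly growing odd primes \<open>n\<^sub>k\<close>. At
  stage \<open>k\<close> one of the first two coordinates, the roles alternating, is
  \<open>p/n\<^sub>k + 1/(n\<^sub>k n\<^sub>k\<^sub>+\<^sub>1^m)\<close>, and the others are fractions in lowest terms with denominators
  \<open>n\<^sub>k\<^sub>+\<^sub>1, n\<^sub>k\<^sub>+\<^sub>1^2, \<dots>, n\<^sub>k\<^sub>+\<^sub>1^(m-1)\<close>. If \<open>q\<theta>\<close> is within \<open>1/(4n\<^sub>k\<^sub>+\<^sub>1)\<close> of an integer vector and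
  \<open>4\<bar>q\<bar> \<le> n\<^sub>k\<^sub>+\<^sub>1^m\<close>, then \<open>q\<close> is divisible by \<open>n\<^sub>k\<close>, digit by digit by \<open>n\<^sub>k\<^sub>+\<^sub>1^(m-1)\<close>, and too small to be
  nonzero; so \<open>\<theta>\<close> is non-singular. In the distinguished coordinate, \<open>n\<^sub>kq\<theta>\<close> is within \<open>3/8\<close> of an
  integer for all these \<open>q\<close>, whereas \<open>n\<^sub>k/2\<close> is a half-integer. Hence \<open>q\<theta>\<close> stays \<open>1/(8n\<^sub>k)\<close> away from
  \<open>1/2\<close> there, which is of order \<open>\<bar>q\<bar>^(-1/m)\<close> once \<open>4\<bar>q\<bar> > n\<^sub>k^m\<close>. Only the first two coordinates of
  \<open>\<eta> = (1/2, \<dots>, 1/2)\<close> matter, so a codimension two coset of a coordinate torus consists of badly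
  approximable points, and the Haar measure on a circle in it is the required algebraic measure.
\<close>

section \<open>Approximation by fractions and divisibility by primes\<close>

text \<open>Of two consecutive integers at most one is divisible by \<open>N\<close>, so the floor
  of \<open>x * N ^ e\<close> or its successor serves as numerator.\<close>

lemma exists_int_approx_not_dvd:
  fixes N :: int and x :: real
  assumes "N > 1"
  shows "\<exists>P :: int. \<not> N dvd P \<and> \<bar>x - P / real_of_int N ^ e\<bar> \<le> 1 / real_of_int N ^ e"
proof -
  define M where "M = real_of_int N ^ e"
  have M: "M > 0" using assms by (simp add: M_def)
  define f where "f = \<lfloor>x * M\<rfloor>"
  have f: "f \<le> x * M" "x * M \<le> f + 1"
    unfolding f_def by linarith+
  have *: "\<bar>x - P / M\<bar> \<le> 1 / M" if "\<bar>x * M - P\<bar> \<le> 1" for P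
  proof -
    have "x - P / M = (x * M - P) / M" using M by (simp add: field_simps)
    then show ?thesis using that M by (simp add: abs_divide divide_right_mono)
  qed
  have "\<not> (N dvd f \<and> N dvd f + 1)"
    using assms by (metis dvd_add_right_iff zdvd_not_zless zero_less_one)
  then consider "\<not> N dvd f" | "\<not> N dvd f + 1" by blast
  then show ?thesis
  proof cases
    case 1 then show ?thesis using *[of f] f unfolding M_def by (intro exI[of _ f]) auto
  next
    case 2 then show ?thesis using *[of "f + 1"] f unfolding M_def by (intro exI[of _ "f + 1"]) auto
  qed
qed

text \<open>The intervals of radius \<open>2 * d k\<close> about \<open>x k\<close> are nested,
  because \<open>d k + 2 * d (Suc k) \<le> 2 * d k\<close>; the supremum of their left endpoints
  lies in all of them.\<close>

lemma exists_real_near_fast_sequence: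
  fixes x d :: "nat \<Rightarrow> real"
  assumes "\<And>k. \<bar>x (Suc k) - x k\<bar> \<le> d k" and "\<And>k. 2 * d (Suc k) \<le> d k"
  shows "\<exists>l. \<forall>k. \<bar>l - x k\<bar> \<le> 2 * d k"
proof -
  define a b where "a = (\<lambda>k. x k - 2 * d k)" and "b = (\<lambda>k. x k + 2 * d k)"
  have "incseq a"
  proof (rule incseq_SucI)
    show "a k \<le> a (Suc k)" for k using assms(1)[of k] assms(2)[of k] by (simp add: a_def abs_le_iff)
  qed
  have "decseq b"
  proof (rule decseq_SucI)
    show "b (Suc k) \<le> b k" for k using assms(1)[of k] assms(2)[of k] by (simp add: b_def abs_le_iff)
  qed
  have ab: "a k \<le> b k" for k
    using assms(1)[of k] by (simp add: a_def b_def)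
  have le: "a j \<le> b k" for j k
  proof -
    have "a j \<le> a (max j k)" using \<open>incseq a\<close> by (simp add: incseqD)
    also have "\<dots> \<le> b (max j k)" by (rule ab)
    also have "\<dots> \<le> b k" using \<open>decseq b\<close> by (simp add: decseqD)
    finally show ?thesis .
  qed
  have "bdd_above (range a)" using le[of _ 0] by (auto simp: bdd_above_def)
  then have "a k \<le> (SUP j. a j)" for k by (intro cSUP_upper) auto
  moreover have "(SUP j. a j) \<le> b k" for k using le by (intro cSUP_least) auto
  ultimately have "\<forall>k. \<bar>(SUP j. a j) - x k\<bar> \<le> 2 * d k"
    unfolding a_def b_def by (smt (verit))
  then show ?thesis by blast
qed

text \<open>Multiplying by \<open>n\<close> turns the hypothesis into a bound below 1 on the integer
  \<open>q * P - z * n\<close>, which therefore vanishes.\<close>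

lemma dvd_if_near_int:
  fixes q z P :: int and n :: nat
  assumes "prime n" "\<not> int n dvd P" "\<bar>real_of_int q * (P / n) - z\<bar> < 1 / n"
  shows "int n dvd q"
proof -
  have n: "n > 0" using assms(1) prime_gt_0_nat by blast
  have "real_of_int (q * P - z * n) = n * (real_of_int q * (P / n) - z)"
    using n by (simp add: field_simps)
  then have "real_of_int \<bar>q * P - z * n\<bar> = n * \<bar>real_of_int q * (P / n) - z\<bar>"
    by (simp only: of_int_abs abs_mult abs_of_nat)
  also have "\<dots> < 1"
    using mult_strict_left_mono[OF assms(3), of n] n by simp
  finally have "\<bar>q * P - z * n\<bar> < 1" by linarith
  then have "q * P = z * n" by simp
  then have "int n dvd q * P" by simp
  then show ?thesis using assms(1,2) by (simp add: prime_dvd_mult_iff)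
qed

text \<open>The powers of \<open>n\<close> are peeled off one at a time: if
  \<open>q = n ^ r * s\<close>, the coordinate of weight \<open>r + 1\<close> sees only
  \<open>s * P / n\<close>, and nearness to an integer forces \<open>n\<close> to divide
  \<open>s\<close>.\<close>

lemma power_dvd_if_near_int:
  fixes x :: "'i \<Rightarrow> real" and P :: "'i \<Rightarrow> int" and q :: int and n :: nat
  assumes "prime n"
    and "\<And>e. e \<in> {1..r} \<Longrightarrow> \<exists>i\<in>A. w i = e"
    and "\<And>i. i \<in> A \<Longrightarrow> \<not> int n dvd P i"
    and "\<And>i. i \<in> A \<Longrightarrow> \<exists>z :: int. \<bar>real_of_int q * (P i / n ^ w i) - z\<bar> < 1 / n"
  shows "int n ^ r dvd q"
  using assms(2)
proof (induction r)
  case (Suc r)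
  have n: "n > 0" using assms(1) prime_gt_0_nat by blast
  have "int n ^ r dvd q" using Suc by simp
  then obtain s where s: "q = int n ^ r * s" by blast
  obtain i where i: "i \<in> A" "w i = Suc r" using Suc.prems[of "Suc r"] by auto
  obtain z :: int where z: "\<bar>real_of_int q * (P i / n ^ w i) - z\<bar> < 1 / n"
    using assms(4)[OF i(1)] by blast
  have "real_of_int q * (P i / n ^ w i) = real_of_int s * (P i / n)"
    using n by (simp add: s i)
  then have "int n dvd s"
    using dvd_if_near_int[OF assms(1) assms(3)[OF i(1)]] z by metis
  then show ?case by (auto simp: s)
qed simp

section \<open>Separation from the integers and from one half at a single stage\<close>

text \<open>If every coordinate were near an integer, coordinate \<open>c\<close> would give
  \<open>q = n * s\<close> and then, since the part \<open>s * p\<close> is integral,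
  \<open>\<bar>s\<bar> < n' ^ (m - 1)\<close>. The other coordinates make
  \<open>n' ^ (m - 1)\<close> divide \<open>q\<close>, hence \<open>s\<close>, which is impossible
  for nonzero \<open>s\<close>.\<close>

lemma some_coordinate_far_from_int:
  fixes \<theta> y :: "'i \<Rightarrow> real" and P :: "'i \<Rightarrow> int" and p q :: int and n n' m :: nat
  assumes n: "prime n" "prime n'" "n > 2" "n' \<ge> 2 * n" and m: "m \<ge> 1"
    and onto: "\<And>e. e \<in> {1..m - 1} \<Longrightarrow> \<exists>i\<in>- {c}. w i = e"
    and p: "\<not> int n dvd p" and P: "\<And>i. i \<noteq> c \<Longrightarrow> \<not> int n' dvd P i"
    and yc: "y c = p / n + 1 / (n * n' ^ m)"
    and y: "\<And>i. i \<noteq> c \<Longrightarrow> y i = P i / n' ^ w i"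
    and err: "\<And>i. \<bar>q * \<theta> i - q * y i\<bar> \<le> 1 / (64 * real n' ^ 2)"
    and q0: "q \<noteq> 0" and q: "4 * \<bar>real_of_int q\<bar> \<le> n' ^ m"
  shows "\<exists>i. \<forall>z :: int. 1 / (4 * n') \<le> \<bar>q * \<theta> i - z\<bar>"
proof (rule ccontr)
  define M where "M = real n'"
  define K where "K = real n"
  have MK: "M \<ge> 2 * K" "K > 2" using n by (auto simp: M_def K_def)
  assume "\<nexists>i. \<forall>z :: int. 1 / (4 * n') \<le> \<bar>q * \<theta> i - z\<bar>"
  then have "\<forall>i. \<exists>z :: int. \<bar>q * \<theta> i - z\<bar> < 1 / (4 * M)" by (auto simp: not_le M_def)
  then obtain z :: "'i \<Rightarrow> int" where z: "\<bar>q * \<theta> i - z i\<bar> < 1 / (4 * M)" for i by metis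
  have small: "1 / (64 * M ^ 2) \<le> 1 / (64 * M)"
    using MK by (intro divide_left_mono) (auto simp: power2_eq_square)
  \<comment> \<open>The constant is 1/4 from the denied conclusion plus 1/64 from replacing
    \<open>\<theta>\<close> by \<open>y\<close>.\<close>
  have near: "\<bar>q * y i - z i\<bar> < 17 / 64 * (1 / M)" for i
  proof -
    have "\<bar>q * y i - z i\<bar> < 1 / (4 * M) + 1 / (64 * M)"
      using z[of i] err[of i] small unfolding M_def by linarith
    then show ?thesis by simp
  qed
  have qM: "\<bar>real_of_int q\<bar> / M ^ m \<le> 1 / 4" using q MK by (simp add: M_def field_simps)
  have qy: "q * y c = q * (p / K) + (q / M ^ m) / K"
    unfolding yc by (simp add: M_def K_def field_simps)
  have arith: "\<bar>u - z'\<bar> < k" if "\<bar>u + v - z'\<bar> < 17 / 64 * r" "r \<le> 1 / 2 * k" "\<bar>v\<bar> \<le> 1 / 4 * k" "k > 0"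
    for u v z' r k :: real
    using that by linarith
  have "1 / M \<le> 1 / (2 * K)" using MK by (intro divide_left_mono) auto
  then have "1 / M \<le> 1 / 2 * (1 / K)" by simp
  moreover have "\<bar>(q / M ^ m) / K\<bar> \<le> 1 / 4 * (1 / K)"
    using divide_right_mono[OF qM, of K] MK by (simp add: abs_divide)
  moreover have "1 / K > 0" using MK by simp
  ultimately have "\<bar>q * (p / K) - z c\<bar> < 1 / K"
    by (rule arith[OF near[of c, unfolded qy]])
  then have "int n dvd q"
    using dvd_if_near_int[OF n(1) p] by (simp add: K_def)
  then obtain s where s: "q = int n * s" by blast
  have sM: "\<bar>s / M ^ m\<bar> \<le> 1 / 4"
  proof -
    have "1 * \<bar>real_of_int s\<bar> \<le> K * \<bar>real_of_int s\<bar>" using MK by (intro mult_right_mono) auto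
    also have "\<dots> = \<bar>real_of_int q\<bar>" by (simp add: s K_def abs_mult)
    finally have "\<bar>real_of_int s\<bar> / M ^ m \<le> \<bar>real_of_int q\<bar> / M ^ m" using MK by (intro divide_right_mono) auto
    then have "\<bar>real_of_int s\<bar> / M ^ m \<le> 1 / 4" using qM by (rule order_trans)
    then show ?thesis using MK by (simp add: abs_divide)
  qed
  have sy: "q * y c = s / M ^ m + real_of_int (s * p)"
    unfolding qy using MK by (simp add: s flip: K_def)
  have "1 / M \<le> 1 / 4" using MK by (simp add: field_simps)
  \<comment> \<open>The nearby integer \<open>z c\<close> must be \<open>s * p\<close> itself, so
    the bound \<open>near\<close> applies to the remainder \<open>s / M ^ m\<close> alone.\<close>
  then have "\<bar>real_of_int (s * p - z c)\<bar> < 1"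
    using near[of c] sM unfolding sy of_int_diff by linarith
  then have "s * p - z c = 0" by linarith
  then have "real_of_int (s * p) = z c" by simp
  moreover have "1 / M > 0" using MK by simp
  ultimately have "\<bar>s / M ^ m\<bar> < 1 / M"
    using near[of c] unfolding sy by linarith
  moreover have "M ^ m = M ^ (m - 1) * M" using m by (metis power_minus_mult less_le_trans zero_less_one)
  ultimately have "\<bar>real_of_int s\<bar> < M ^ (m - 1)" using MK by (simp add: field_simps abs_mult)
  then have "real_of_int \<bar>s\<bar> < real_of_int (int n' ^ (m - 1))" by (simp add: M_def)
  then have s_less: "\<bar>s\<bar> < int n' ^ (m - 1)" by (simp only: of_int_less_iff)
  have "int n' ^ (m - 1) dvd q"
  proof (rule power_dvd_if_near_int[OF n(2)])
    show "\<exists>i\<in>- {c}. w i = e" if "e \<in> {1..m - 1}" for e using onto[OF that] .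
    show "\<not> int n' dvd P i" if "i \<in> - {c}" for i using P that by simp
    show "\<exists>z :: int. \<bar>q * (P i / n' ^ w i) - z\<bar> < 1 / n'" if "i \<in> - {c}" for i
    proof -
      have "1 / M > 0" using MK by simp
      then have "\<bar>q * y i - z i\<bar> < 1 / M" using near[of i] by linarith
      then show ?thesis using y[of i] that unfolding M_def by auto
    qed
  qed
  moreover have "coprime (int n' ^ (m - 1)) (int n)"
    using primes_coprime[of n' n] n by (simp add: coprime_power_left_iff)
  ultimately have "int n' ^ (m - 1) dvd s"
    unfolding s by (simp add: coprime_dvd_mult_right_iff)
  moreover have "s \<noteq> 0" using q0 s by auto
  ultimately have "\<bar>int n' ^ (m - 1)\<bar> \<le> \<bar>s\<bar>" by (rule dvd_imp_le_int[rotated])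
  then show False using s_less by simp
qed

text \<open>After multiplication by the odd \<open>n\<close> the target \<open>n / 2\<close> is a
  half-integer, while \<open>n * q * y\<close> differs from an integer by at most 1/4. With the
  error 1/64 at least \<open>1/2 - 1/4 - 1/64\<close> remains, which exceeds 1/8.\<close>

lemma odd_denominator_coordinate_far_from_half:
  fixes t y :: real and p q z :: int and n n' m :: nat
  assumes n: "odd n" "n > 2" "n' \<ge> 2 * n"
    and y: "y = p / n + 1 / (n * n' ^ m)"
    and err: "\<bar>q * t - q * y\<bar> \<le> 1 / (64 * real n' ^ 2)"
    and q: "4 * \<bar>real_of_int q\<bar> \<le> n' ^ m"
  shows "1 / (8 * n) \<le> \<bar>q * t - 1 / 2 - z\<bar>"
proof -
  define M where "M = real n'"
  define K where "K = real n"
  have MK: "M \<ge> 2 * K" "K > 2" using n by (auto simp: M_def K_def)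
  obtain h where h: "n = 2 * h + 1" using n(1) by (rule oddE)
  then have Kh: "K = 2 * real h + 1" by (simp add: K_def)
  have "\<bar>real_of_int q\<bar> / M ^ m \<le> 1 / 4" using q MK by (simp add: M_def field_simps)
  then have qM: "\<bar>q / M ^ m\<bar> \<le> 1 / 4" using MK by (simp add: abs_divide)
  have eq: "K * (q * y) = q * p + q / M ^ m"
    unfolding y using MK by (simp add: field_simps flip: M_def K_def)
  have "K * \<bar>q * t - q * y\<bar> \<le> K * (1 / (64 * M ^ 2))"
    using err MK unfolding M_def by (intro mult_left_mono) auto
  also have "\<dots> \<le> 1 / 64"
  proof -
    have "M * 1 \<le> M * M" using MK by (intro mult_left_mono) auto
    then have "K \<le> M * M" using MK by linarith
    then show ?thesis using MK by (simp add: field_simps power2_eq_square)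
  qed
  also have "K * \<bar>q * t - q * y\<bar> = \<bar>K * (q * t) - K * (q * y)\<bar>"
    using MK by (simp add: abs_mult flip: right_diff_distrib)
  finally have e: "\<bar>K * (q * t) - K * (q * y)\<bar> \<le> 1 / 64" .
  define j where "j = q * p - int h - int n * z"
  have "real_of_int j = q * p - h - K * z" by (simp add: j_def K_def)
  then have "K * (q * t - 1 / 2 - z) = real_of_int j - 1 / 2 + q / M ^ m + (K * (q * t) - K * (q * y))"
    unfolding eq using Kh by (simp add: algebra_simps)
  moreover have "\<bar>real_of_int j - 1 / 2\<bar> \<ge> 1 / 2"
  proof (cases "j \<ge> 1")
    case False
    then have "real_of_int j \<le> 0" by simp
    then show ?thesis by linarith
  qed auto
  ultimately have "1 / 8 \<le> \<bar>K * (q * t - 1 / 2 - z)\<bar>"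
    using qM e by linarith
  also have "\<dots> = K * \<bar>q * t - 1 / 2 - z\<bar>" using MK by (simp add: abs_mult)
  finally show ?thesis using n(2) by (simp add: K_def field_simps)
qed

section \<open>Inductive construction of the vector\<close>

text \<open>In the application \<open>c\<close> alternates between two coordinates of weight 1 and
  the others have weights 2 to \<open>m - 1\<close>, so removing either of the two still leaves
  every exponent available.\<close>

locale alternating_coordinates =
  fixes c :: "nat \<Rightarrow> 'i" and w :: "'i \<Rightarrow> nat" and m :: nat
  assumes m: "m \<ge> 2"
    and c_Suc: "\<And>k. c (Suc k) \<noteq> c k"
    and w_c: "\<And>k. w (c k) = 1"
    and w_pos: "\<And>i. w i \<ge> 1"
    and w_onto: "\<And>k e. e \<in> {1..m - 1} \<Longrightarrow> \<exists>i\<in>- {c k}. w i = e"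
begin

text \<open>The coordinate \<open>c k\<close> is the distinguished one at stage \<open>k\<close>, and the coordinate \<open>i \<noteq> c k\<close> receives
  the denominator \<open>n' ^ w i\<close>; since \<open>w (c (Suc k)) = 1\<close>, the next distinguished coordinate has
  denominator \<open>n'\<close>, as the next stage needs.\<close>

definition stage :: "nat \<Rightarrow> nat \<times> ('i \<Rightarrow> real) \<Rightarrow> bool" where
  "stage k s \<longleftrightarrow> (case s of (n, x) \<Rightarrow>
     prime n \<and> odd n \<and> (\<exists>p :: int. \<not> int n dvd p \<and> x (c k) = p / n))"

definition step :: "nat \<Rightarrow> nat \<times> ('i \<Rightarrow> real) \<Rightarrow> nat \<times> ('i \<Rightarrow> real) \<Rightarrow> bool" where
  "step k s s' \<longleftrightarrow> (case (s, s') of ((n, x), (n', x')) \<Rightarrow>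
     n' \<ge> 32 * n ^ (m + 2) \<and>
     x' (c k) = x (c k) + 1 / (n * n' ^ m) \<and>
     (\<forall>i. i \<noteq> c k \<longrightarrow> (\<exists>P :: int. \<not> int n' dvd P \<and> x' i = P / n' ^ w i)) \<and>
     (\<forall>i. \<bar>x' i - x i\<bar> \<le> 1 / n'))"

lemma step_exists:
  assumes "stage k s"
  shows "\<exists>s'. stage (Suc k) s' \<and> step k s s'"
proof -
  obtain n x where s: "s = (n, x)" by force
  \<comment> \<open>The summand 2 makes the prime exceed 2 and hence odd.\<close>
  obtain n' where n': "prime n'" "n' > 32 * n ^ (m + 2) + 2"
    using bigger_prime by blast
  have odd: "odd n'" using n' prime_odd_nat[of n'] by simp
  have n0: "n > 0" "n' > 1" using assms n' by (auto simp: s stage_def prime_gt_0_nat)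
  have inv_le: "1 / real n' ^ e \<le> 1 / n'" if "e \<ge> 1" for e
  proof -
    have "real n' ^ 1 \<le> real n' ^ e" using that n0 by (intro power_increasing) auto
    then show ?thesis using n0 by (simp add: frac_le)
  qed
  have "\<exists>P :: int. \<not> int n' dvd P \<and> \<bar>x i - P / n' ^ w i\<bar> \<le> 1 / n' ^ w i" for i
    using exists_int_approx_not_dvd[of "int n'" "x i" "w i"] n0 by simp
  then obtain P :: "'i \<Rightarrow> int"
    where P: "\<not> int n' dvd P i" "\<bar>x i - P i / n' ^ w i\<bar> \<le> 1 / n' ^ w i" for i
    by metis
  define x' where "x' = (\<lambda>i. P i / n' ^ w i)(c k := x (c k) + 1 / (n * n' ^ m))"
  have "stage (Suc k) (n', x')"
    using n' odd P(1) c_Suc[of k] by (auto simp: stage_def x'_def w_c)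
  moreover have "\<bar>x' i - x i\<bar> \<le> 1 / n'" for i
  proof (cases "i = c k")
    case True
    have "1 / (real n * n' ^ m) \<le> 1 / real n' ^ m"
      using n0 by (intro divide_left_mono) auto
    also have "\<dots> \<le> 1 / n'" using inv_le m by simp
    finally show ?thesis using True n0 by (simp add: x'_def)
  next
    case False
    then show ?thesis using P(2)[of i] inv_le[OF w_pos[of i]]
      by (simp add: x'_def abs_minus_commute)
  qed
  then have "step k s (n', x')"
    using n' P(1) by (auto simp: step_def s x'_def)
  ultimately show ?thesis by blast
qed

text \<open>Iterating \<open>step\<close> and passing to the limit in each coordinate, both
  separation lemmas are applied with \<open>y = x (Suc k)\<close>. The value \<open>n 0 = 3\<close>
  is recorded so that the smallest \<open>q\<close> can be treated at stage 0.\<close>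

lemma exists_nonsingular_avoiding_half:
  "\<exists>(\<theta> :: 'i \<Rightarrow> real) (n :: nat \<Rightarrow> nat). strict_mono n \<and> n 0 = 3 \<and>
     (\<forall>k q. q \<noteq> 0 \<longrightarrow> 4 * \<bar>real_of_int q\<bar> \<le> n (Suc k) ^ m \<longrightarrow>
        (\<exists>i. \<forall>z :: int. 1 / (4 * n (Suc k)) \<le> \<bar>q * \<theta> i - z\<bar>)) \<and>
     (\<forall>k q. 4 * \<bar>real_of_int q\<bar> \<le> n (Suc k) ^ m \<longrightarrow>
        (\<forall>z :: int. 1 / (8 * n k) \<le> \<bar>q * \<theta> (c k) - 1 / 2 - z\<bar>))"
proof -
  have "stage 0 (3, \<lambda>_. 1 / 3)"
    by (auto simp: stage_def intro!: exI[of _ 1])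
  then obtain f where f0: "f 0 = (3, \<lambda>_. 1 / 3)" and stage: "\<And>k. stage k (f k)"
    and step: "\<And>k. step k (f k) (f (Suc k))"
    \<comment> \<open>The extra conjunct pins the start of the chosen sequence to
      \<open>(3, \<lambda>_. 1 / 3)\<close>.\<close>
    using dependent_nat_choice[of "\<lambda>k s. stage k s \<and> (k = 0 \<longrightarrow> s = (3, \<lambda>_. 1 / 3))" step]
      step_exists by (metis nat.distinct(1))
  define n x where "n = (\<lambda>k. fst (f k))" and "x = (\<lambda>k. snd (f k))"
  have prime: "prime (n k)" and odd: "odd (n k)"
    and p_ex: "\<exists>p :: int. \<not> int (n k) dvd p \<and> x k (c k) = p / n k" for k
    using stage[of k] by (auto simp: stage_def n_def x_def split: prod.splits)
  have growth: "n (Suc k) \<ge> 32 * n k ^ (m + 2)"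
    and xc: "x (Suc k) (c k) = x k (c k) + 1 / (n k * n (Suc k) ^ m)"
    and P_ex: "i \<noteq> c k \<Longrightarrow> \<exists>P :: int. \<not> int (n (Suc k)) dvd P \<and> x (Suc k) i = P / n (Suc k) ^ w i"
    and diff: "\<bar>x (Suc k) i - x k i\<bar> \<le> 1 / n (Suc k)" for k i
    using step[of k] by (auto simp: step_def n_def x_def split: prod.splits)
  have n_gt: "n k > 2" for k
    using prime[of k] odd[of k] by (metis prime_ge_2_nat dvd_refl le_neq_implies_less)
  have growth2: "2 * n k \<le> n (Suc k)" for k
  proof -
    have "n k \<le> n k ^ (m + 2)" using n_gt[of k] by (intro self_le_power) auto
    then have "2 * n k \<le> 32 * n k ^ (m + 2)" by (intro mult_le_mono) auto
    then show ?thesis using growth[of k] by (rule le_trans)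
  qed
  have mono: "strict_mono n"
    unfolding strict_mono_Suc_iff
  proof
    show "n k < n (Suc k)" for k using growth2[of k] n_gt[of k] by linarith
  qed
  have "\<exists>l. \<forall>k. \<bar>l - x k i\<bar> \<le> 2 * (1 / n (Suc k))" for i
  proof (rule exists_real_near_fast_sequence)
    show "\<bar>x (Suc k) i - x k i\<bar> \<le> 1 / n (Suc k)" for k by (rule diff)
    show "2 * (1 / real (n (Suc (Suc k)))) \<le> 1 / n (Suc k)" for k
    proof -
      have "real (2 * n (Suc k)) \<le> n (Suc (Suc k))"
        using growth2[of "Suc k"] by (simp only: of_nat_le_iff)
      then show ?thesis using n_gt[of "Suc k"] by (simp add: field_simps)
    qed
  qed
  then obtain \<theta> where \<theta>: "\<bar>\<theta> i - x k i\<bar> \<le> 2 * (1 / n (Suc k))" for i k by metis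
  have err: "\<bar>q * \<theta> i - q * x (Suc k) i\<bar> \<le> 1 / (64 * real (n (Suc k)) ^ 2)"
    if q: "4 * \<bar>real_of_int q\<bar> \<le> n (Suc k) ^ m" for k i q
  proof -
    define M where "M = real (n (Suc k))"
    have M: "M > 0" using n_gt[of "Suc k"] by (simp add: M_def)
    have "\<bar>\<theta> i - x (Suc k) i\<bar> \<le> 2 / n (Suc (Suc k))" using \<theta>[of i "Suc k"] by simp
    also have "\<dots> \<le> 2 / (32 * M ^ (m + 2))"
    proof (intro divide_left_mono)
      have "real (32 * n (Suc k) ^ (m + 2)) \<le> n (Suc (Suc k))"
        using growth by (simp only: of_nat_le_iff)
      then show "32 * M ^ (m + 2) \<le> n (Suc (Suc k))" by (simp add: M_def)
      show "0 < real (n (Suc (Suc k))) * (32 * M ^ (m + 2))"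
        using M n_gt[of "Suc (Suc k)"] by simp
    qed simp
    finally have "\<bar>q\<bar> * \<bar>\<theta> i - x (Suc k) i\<bar> \<le> (M ^ m / 4) * (2 / (32 * M ^ (m + 2)))"
      using q M by (intro mult_mono) (auto simp: M_def)
    also have "\<dots> = 1 / (64 * M ^ 2)"
      using M by (simp add: power_add power2_eq_square)
    finally show ?thesis by (simp add: M_def flip: abs_mult right_diff_distrib)
  qed
  have nonsing: "\<exists>i. \<forall>z :: int. 1 / (4 * n (Suc k)) \<le> \<bar>q * \<theta> i - z\<bar>"
    if "q \<noteq> 0" and q: "4 * \<bar>real_of_int q\<bar> \<le> n (Suc k) ^ m" for k q
  proof -
    obtain p :: int where p: "\<not> int (n k) dvd p" "x k (c k) = p / n k" using p_ex by blast
    obtain P :: "'i \<Rightarrow> int"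
      where P: "i \<noteq> c k \<Longrightarrow> \<not> int (n (Suc k)) dvd P i \<and> x (Suc k) i = P i / n (Suc k) ^ w i" for i
      using P_ex[of _ k] by metis
    show ?thesis
    proof (rule some_coordinate_far_from_int[OF prime[of k] prime[of "Suc k"] n_gt growth2 _ _ p(1)])
      show "1 \<le> m" using m by simp
      show "\<exists>i\<in>- {c k}. w i = e" if "e \<in> {1..m - 1}" for e using that by (rule w_onto)
      show "\<not> int (n (Suc k)) dvd P i" if "i \<noteq> c k" for i using P[OF that] by blast
      show "x (Suc k) (c k) = p / n k + 1 / (n k * n (Suc k) ^ m)" using xc[of k] p(2) by simp
      show "x (Suc k) i = P i / n (Suc k) ^ w i" if "i \<noteq> c k" for i using P[OF that] by blast
      show "\<bar>q * \<theta> i - q * x (Suc k) i\<bar> \<le> 1 / (64 * real (n (Suc k)) ^ 2)" for i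
        using q by (rule err)
    qed (fact that)+
  qed
  have away: "1 / (8 * n k) \<le> \<bar>q * \<theta> (c k) - 1 / 2 - z\<bar>"
    if q: "4 * \<bar>real_of_int q\<bar> \<le> n (Suc k) ^ m" for k q and z :: int
  proof -
    obtain p :: int where "x k (c k) = p / n k" using p_ex by blast
    then show ?thesis
      using xc[of k] err[OF q, of "c k"]
      by (intro odd_denominator_coordinate_far_from_half[OF odd n_gt growth2 _ _ q]) auto
  qed
  have "n 0 = 3" by (simp add: n_def f0)
  with mono nonsing away show ?thesis by blast
qed

end


subsection \<open>Norms, the torus and \<^const>\<open>Bad\<close>\<close>

lemma is_norm_minus_commute:
  assumes "is_norm N"
  shows "N (x - y) = N (y - x)"
proof -
  have "N (x - y) = N ((-1) *\<^sub>R (y - x))" by simp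
  also have "\<dots> = \<bar>-1\<bar> * N (y - x)" using assms unfolding is_norm_def by blast
  finally show ?thesis by simp
qed

text \<open>Expand \<open>x\<close> in the standard basis and use subadditivity; the added 1 makes
  positivity of \<open>C\<close> immediate.\<close>

lemma is_norm_le_norm:
  fixes N :: "'a::euclidean_space \<Rightarrow> real"
  assumes "is_norm N"
  shows "\<exists>C>0. \<forall>x. N x \<le> C * norm x"
proof -
  have nonneg: "N x \<ge> 0" and tri: "N (x + y) \<le> N x + N y" and scale: "N (c *\<^sub>R x) = \<bar>c\<bar> * N x"
    and zero: "N 0 = 0" for x y c
    using assms by (auto simp: is_norm_def)
  have sum: "N (sum f A) \<le> (\<Sum>i\<in>A. N (f i))" for f and A :: "'a set"
  proof (induction A rule: infinite_finite_induct)
    case (insert i A)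
    then show ?case using tri[of "f i" "sum f A"] by simp
  qed (simp_all add: zero)
  define C where "C = (\<Sum>i\<in>Basis. N i) + 1"
  have "N x \<le> C * norm x" for x
  proof -
    have "N x = N (\<Sum>i\<in>Basis. (x \<bullet> i) *\<^sub>R i)" by (simp add: euclidean_representation)
    also have "\<dots> \<le> (\<Sum>i\<in>Basis. \<bar>x \<bullet> i\<bar> * N i)" using sum[of "\<lambda>i. (x \<bullet> i) *\<^sub>R i" Basis] by (simp add: scale)
    also have "\<dots> \<le> (\<Sum>i\<in>Basis. norm x * N i)"
      by (intro sum_mono mult_right_mono nonneg) (rule Basis_le_norm)
    also have "\<dots> = norm x * (\<Sum>i\<in>Basis. N i)" by (rule sum_distrib_left[symmetric])
    also have "\<dots> \<le> C * norm x" by (simp add: C_def algebra_simps)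
    finally show ?thesis .
  qed
  moreover have "C > 0" unfolding C_def by (intro add_nonneg_pos sum_nonneg nonneg) simp
  ultimately show ?thesis by blast
qed

lemma is_norm_diff_le:
  assumes "is_norm N"
  shows "\<bar>N x - N y\<bar> \<le> N (x - y)"
proof -
  have tri: "N (a + b) \<le> N a + N b" for a b using assms by (simp add: is_norm_def)
  show ?thesis
    using tri[of "x - y" y] tri[of "y - x" x] is_norm_minus_commute[OF assms, of x y] by simp
qed

text \<open>Serves both \<open>N\<close> itself and \<open>dist_int N\<close>, each of which is
  1-Lipschitz with respect to \<open>N\<close>.\<close>

lemma continuous_on_is_norm_Lipschitz:
  fixes N :: "'a::euclidean_space \<Rightarrow> real" and f :: "'a \<Rightarrow> real"
  assumes "is_norm N" and "\<And>x y. \<bar>f x - f y\<bar> \<le> N (x - y)"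
  shows "continuous_on S f"
proof -
  obtain C where C: "C > 0" "\<And>x. N x \<le> C * norm x" using is_norm_le_norm[OF assms(1)] by blast
  have "C-lipschitz_on S f"
  proof (rule lipschitz_onI)
    show "dist (f x) (f y) \<le> C * dist x y" for x y
      using order_trans[OF assms(2) C(2)] by (simp add: dist_norm)
  qed (use C in simp)
  then show ?thesis by (rule lipschitz_on_continuous_on)
qed

text \<open>The constant is the minimum of \<open>N\<close> on the compact unit sphere; homogeneity
  extends the bound to all vectors.\<close>

lemma norm_le_is_norm:
  fixes N :: "'a::euclidean_space \<Rightarrow> real"
  assumes "is_norm N"
  shows "\<exists>\<kappa>>0. \<forall>x. \<kappa> * norm x \<le> N x"
proof -
  have pos: "N x > 0" if "x \<noteq> 0" for x using assms that by (metis is_norm_def less_eq_real_def)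
  have scale: "N (c *\<^sub>R x) = \<bar>c\<bar> * N x" for c x using assms by (simp add: is_norm_def)
  have "continuous_on (sphere 0 1) N"
    using continuous_on_is_norm_Lipschitz[OF assms is_norm_diff_le[OF assms]] .
  moreover have "sphere (0::'a) 1 \<noteq> {}"
    using SOME_Basis norm_Basis by fastforce
  ultimately obtain u where u: "u \<in> sphere 0 1" "\<And>y. y \<in> sphere 0 1 \<Longrightarrow> N u \<le> N y"
    using continuous_attains_inf[of "sphere 0 1" N] by auto
  have "N u * norm x \<le> N x" for x
  proof (cases "x = 0")
    case False
    then have "N u \<le> N ((1 / norm x) *\<^sub>R x)" by (intro u(2)) simp
    then show ?thesis using False unfolding scale by (simp add: field_simps)
  qed (use scale[of 0] in simp)
  moreover have "N u > 0" using u(1) by (intro pos) auto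
  ultimately show ?thesis by blast
qed

lemma bdd_below_is_norm:
  assumes "is_norm N"
  shows "bdd_below ((\<lambda>p. N (f p)) ` A)"
  using assms by (intro bdd_belowI2[of _ 0]) (simp add: is_norm_def)

text \<open>This transfers the estimates on a single coordinate to the given norm, with one
  \<open>\<kappa>\<close> for all vectors, coordinates and radii.\<close>

lemma dist_int_ge:
  fixes N :: "real ^ 'm \<Rightarrow> real"
  assumes "is_norm N"
  shows "\<exists>\<kappa>>0. \<forall>z i r. (\<forall>p :: int. r \<le> \<bar>z $ i - p\<bar>) \<longrightarrow> \<kappa> * r \<le> dist_int N z"
proof -
  obtain \<kappa> where \<kappa>: "\<kappa> > 0" "\<And>x. \<kappa> * norm x \<le> N x" using norm_le_is_norm[OF assms] by blast
  have "\<kappa> * r \<le> dist_int N z" if r: "\<forall>p :: int. r \<le> \<bar>z $ i - p\<bar>" for z i r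
    unfolding dist_int_def
  proof (rule cINF_greatest)
    fix p :: "real ^ 'm" assume "p \<in> int_vecs"
    then have "p $ i \<in> \<int>" by (simp add: int_vecs_def)
    then have "r \<le> \<bar>(z - p) $ i\<bar>" using r by (auto elim: Ints_cases)
    then have "r \<le> norm (z - p)" using component_le_norm_cart order_trans by blast
    then have "\<kappa> * r \<le> \<kappa> * norm (z - p)" using \<kappa>(1) by simp
    then show "\<kappa> * r \<le> N (z - p)" using \<kappa>(2) by (rule order_trans)
  qed (use int_vecs_0 in blast)
  then show ?thesis using \<kappa>(1) by blast
qed

lemma continuous_on_dist_int:
  fixes N :: "real ^ 'm \<Rightarrow> real"
  assumes "is_norm N"
  shows "continuous_on S (dist_int N)"
proof (rule continuous_on_is_norm_Lipschitz[OF assms])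
  have "dist_int N x - N (x - y) \<le> dist_int N y" for x y
    unfolding dist_int_def[of N y]
  proof (rule cINF_greatest)
    fix p :: "real ^ 'm" assume "p \<in> int_vecs"
    then have "dist_int N x \<le> N (x - p)"
      unfolding dist_int_def by (intro cINF_lower bdd_below_is_norm[OF assms])
    also have "N ((x - y) + (y - p)) \<le> N (x - y) + N (y - p)"
      using assms unfolding is_norm_def by blast
    then have "N (x - p) \<le> N (x - y) + N (y - p)" by simp
    finally show "dist_int N x - N (x - y) \<le> N (y - p)" by simp
  qed (use int_vecs_0 in blast)
  from this[of x y for x y] this[of y x for x y] show "\<bar>dist_int N x - dist_int N y\<bar> \<le> N (x - y)" for x y
    using is_norm_minus_commute[OF assms, of x y] by (smt (verit))
qed

section \<open>Topology of the torus and measurability of \<open>Bad\<close>\<close>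

lemma continuous_on_to_torus: "continuous_on UNIV to_torus"
  by (simp add: continuous_on_open_vimage open_torus_def)

lemma continuous_on_torusI:
  assumes "continuous_on UNIV (\<lambda>x. f (to_torus x))"
  shows "continuous_on UNIV f"
  using assms by (auto simp: continuous_on_open_vimage open_torus_def vimage_def)

lemma torus_add: "to_torus x + to_torus y = to_torus (x + y)"
  and torus_diff: "to_torus x - to_torus y = to_torus (x - y)"
  and torus_dist0_to_torus: "torus_dist0 N (to_torus x) = dist_int N x"
  by (simp_all add: plus_torus.abs_eq minus_torus.abs_eq torus_dist0.abs_eq)

lemma continuous_on_torus_translate: "continuous_on UNIV (\<lambda>z. z + to_torus u)"
proof (rule continuous_on_torusI)
  show "continuous_on UNIV (\<lambda>x. to_torus x + to_torus u)"
    unfolding torus_add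
    by (intro continuous_on_compose2[OF continuous_on_to_torus] continuous_intros) auto
qed

text \<open>A positive liminf is one that eventually stays above some \<open>1 / Suc j\<close>. All
  quantifiers now range over countable sets, as measurability requires.\<close>

lemma Bad_iff:
  "\<eta> \<in> Bad N \<theta> \<longleftrightarrow> (\<exists>(j::nat) (K::int). \<forall>q. \<bar>q\<bar> \<ge> K \<longrightarrow>
     1 / Suc j \<le> real_of_int \<bar>q\<bar> powr (1 / CARD('m)) *
       torus_dist0 N (to_torus (real_of_int q *\<^sub>R \<theta>) - \<eta>))"
  for \<theta> :: "real ^ 'm"
proof -
  define f where "f q = real_of_int \<bar>q\<bar> powr (1 / CARD('m)) *
      torus_dist0 N (to_torus (real_of_int q *\<^sub>R \<theta>) - \<eta>)" for q
  define F where "F = filtercomap (\<lambda>q :: int. \<bar>q\<bar>) at_top"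
  have ev: "eventually P F \<longleftrightarrow> (\<exists>K. \<forall>q. \<bar>q\<bar> \<ge> K \<longrightarrow> P q)" for P
    by (simp add: F_def eventually_filtercomap_at_top_linorder)
  have "0 < Liminf F (\<lambda>q. ereal (f q)) \<longleftrightarrow> (\<exists>j. eventually (\<lambda>q. 1 / Suc j \<le> f q) F)"
  proof
    assume "0 < Liminf F (\<lambda>q. ereal (f q))"
    then obtain r where r: "0 < ereal r" "ereal r < Liminf F (\<lambda>q. ereal (f q))"
      using ereal_dense2 by blast
    obtain j where "1 / Suc j < r"
      using r(1) reals_Archimedean[of r] by (auto simp: inverse_eq_divide)
    then have "eventually (\<lambda>q. 1 / Suc j \<le> f q) F"
      using less_LiminfD[OF r(2)] by (auto elim!: eventually_mono)
    then show "\<exists>j. eventually (\<lambda>q. 1 / Suc j \<le> f q) F" ..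
  next
    assume "\<exists>j. eventually (\<lambda>q. 1 / Suc j \<le> f q) F"
    then obtain j where "eventually (\<lambda>q. 1 / Suc j \<le> f q) F" ..
    then have "ereal (1 / Suc j) \<le> Liminf F (\<lambda>q. ereal (f q))"
      by (intro Liminf_bounded) simp
    moreover have "0 < ereal (1 / Suc j)" by simp
    ultimately show "0 < Liminf F (\<lambda>q. ereal (f q))" by (rule less_le_trans[rotated])
  qed
  then show ?thesis unfolding Bad_def mem_Collect_eq F_def[symmetric] f_def[symmetric] ev .
qed

text \<open>For fixed \<open>j\<close> and \<open>K\<close> the condition in \<open>Bad_iff\<close>
  is an intersection of closed sets, so \<open>Bad\<close> is a countable union of closed
  sets.\<close>

lemma Bad_in_borel:
  fixes N :: "real ^ 'm \<Rightarrow> real"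
  assumes "is_norm N"
  shows "Bad N \<theta> \<in> sets borel"
proof -
  define f where "f q \<eta> = real_of_int \<bar>q\<bar> powr (1 / CARD('m)) *
      torus_dist0 N (to_torus (real_of_int q *\<^sub>R \<theta>) - \<eta>)" for q \<eta>
  have cont: "continuous_on UNIV (f q)" for q
  proof (rule continuous_on_torusI)
    show "continuous_on UNIV (\<lambda>x. f q (to_torus x))"
      unfolding f_def torus_diff torus_dist0_to_torus
      by (intro continuous_intros continuous_on_compose2[OF continuous_on_dist_int[OF assms]]) auto
  qed
  have "closed {\<eta>. 1 / Suc j \<le> f q \<eta>}" for j q
    by (intro closed_Collect_le cont continuous_intros)
  then have "closed (\<Inter>q\<in>{q. \<bar>q\<bar> \<ge> K}. {\<eta>. 1 / Suc j \<le> f q \<eta>})" for j K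
    by (intro closed_INT) blast
  then have "(\<Union>j. \<Union>K. \<Inter>q\<in>{q. \<bar>q\<bar> \<ge> K}. {\<eta>. 1 / Suc j \<le> f q \<eta>}) \<in> sets borel"
    by (intro sets.countable_UN borel_closed) auto
  also have "(\<Union>j. \<Union>K. \<Inter>q\<in>{q. \<bar>q\<bar> \<ge> K}. {\<eta>. 1 / Suc j \<le> f q \<eta>}) = Bad N \<theta>"
    by (rule set_eqI) (simp only: Bad_iff f_def UN_iff INT_iff mem_Collect_eq, blast)
  finally show ?thesis .
qed

section \<open>Coordinate subspaces and their lattices\<close>

definition coordinate_subspace :: "'m set \<Rightarrow> (real ^ 'm) set" where
  "coordinate_subspace J = {x. \<forall>i. i \<notin> J \<longrightarrow> x $ i = 0}"

lemma dim_coordinate_subspace: "dim (coordinate_subspace J) = card J"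
  unfolding coordinate_subspace_def by (simp add: dim_substandard_cart flip: dim_vec_eq)

lemma uniform_discrete_int_vecs: "uniform_discrete (int_vecs :: (real ^ 'm) set)"
proof (rule uniformI1[of 1])
  fix x y :: "real ^ 'm" assume xy: "x \<in> int_vecs" "y \<in> int_vecs" "dist x y < 1"
  have "x $ i = y $ i" for i
  proof -
    have "x $ i - y $ i \<in> \<int>" using xy by (simp add: int_vecs_def)
    moreover have "\<bar>x $ i - y $ i\<bar> < 1"
      using xy(3) component_le_norm_cart[of "x - y" i] by (simp add: dist_norm)
    ultimately show ?thesis by (metis Ints_nonzero_abs_less1 eq_iff_diff_eq_0)
  qed
  then show "x = y" by (simp add: vec_eq_iff)
qed simp

text \<open>The standard basis vectors indexed by \<open>J\<close> are integral and span the
  subspace; discreteness is inherited from the integer lattice.\<close>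

lemma rational_subspace_coordinate_subspace: "rational_subspace (coordinate_subspace J)"
proof -
  let ?U = "coordinate_subspace J :: (real ^ 'a) set"
  have U: "subspace ?U" by (auto simp: subspace_def coordinate_subspace_def)
  have "?U \<subseteq> span (?U \<inter> int_vecs)"
  proof
    fix x assume x: "x \<in> ?U"
    have "(x $ i) *\<^sub>R axis i 1 \<in> span (?U \<inter> int_vecs)" for i
    proof (cases "i \<in> J")
      case True
      then have "axis i 1 \<in> ?U \<inter> int_vecs"
        by (auto simp: coordinate_subspace_def int_vecs_def axis_def)
      then show ?thesis by (intro span_scale span_base)
    qed (use x in \<open>simp add: coordinate_subspace_def span_zero\<close>)
    then have "(\<Sum>i\<in>UNIV. (x $ i) *\<^sub>R axis i 1) \<in> span (?U \<inter> int_vecs)" by (intro span_sum)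
    then show "x \<in> span (?U \<inter> int_vecs)"
      using basis_expansion[of x] by (simp add: scalar_mult_eq_scaleR)
  qed
  then have "span (?U \<inter> int_vecs) = ?U"
    using span_minimal[OF _ U, of "?U \<inter> int_vecs"] by blast
  moreover have "discrete (?U \<inter> int_vecs)"
    by (rule uniform_discrete_imp_discrete[OF uniform_discrete_subset[OF uniform_discrete_int_vecs]]) simp
  ultimately show ?thesis
    using U by (auto simp: rational_subspace_def lattice_in_def subspace_0 subspace_diff int_vecs_diff)
qed

section \<open>Invariant measure on a circle in the torus\<close>

lemma emeasure_lborel_translate:
  fixes c :: real
  assumes "A \<in> sets borel"
  shows "emeasure lborel {t. t + c \<in> A} = emeasure lborel A"
proof -
  have "emeasure lborel A = emeasure (distr lborel borel ((+) c)) A" by (simp add: lborel_distr_plus)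
  also have "\<dots> = emeasure lborel ((+) c -` A)" using assms by (subst emeasure_distr) auto
  also have "(+) c -` A = {t. t + c \<in> A}" by (auto simp: add.commute)
  finally show ?thesis by simp
qed

text \<open>Only \<open>r = frac s\<close> matters. Translation by \<open>r\<close> carries the unit
  interval to \<open>[r, 1 + r)\<close>, and periodicity moves the part beyond 1 back to
  \<open>[0, r)\<close>.\<close>

lemma emeasure_lborel_periodic_translate:
  fixes B :: "real set"
  assumes B: "B \<in> sets borel" and periodic: "\<And>t (k::int). t + k \<in> B \<longleftrightarrow> t \<in> B"
  shows "emeasure lborel ({0..<1} \<inter> {t. t + s \<in> B}) = emeasure lborel ({0..<1} \<inter> B)"
proof -
  define r where "r = frac s"
  have r: "0 \<le> r" "r < 1" by (simp_all add: r_def frac_lt_1)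
  have s: "t + s \<in> B \<longleftrightarrow> t + r \<in> B" for t
    using periodic[of "t + r" "\<lfloor>s\<rfloor>"] by (simp add: r_def frac_def add.assoc)
  have meas: "{t. t + c \<in> A} \<in> sets borel" if "A \<in> sets borel" for c :: real and A
    using measurable_sets[of "\<lambda>t. t + c" borel borel A] that by (simp add: vimage_def)
  have eq: "{0..<1} \<inter> {t. t + s \<in> B} = {t. t + r \<in> {r..<1} \<inter> B} \<union> {t. t + (r - 1) \<in> {0..<r} \<inter> B}"
    using periodic[of "_ + r" "-1"] r by (auto simp: s add_diff_eq)
  have "emeasure lborel ({0..<1} \<inter> {t. t + s \<in> B}) =
      emeasure lborel {t. t + r \<in> {r..<1} \<inter> B} + emeasure lborel {t. t + (r - 1) \<in> {0..<r} \<inter> B}"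
    unfolding eq using B by (intro plus_emeasure[symmetric]) (auto intro!: meas)
  also have "\<dots> = emeasure lborel ({r..<1} \<inter> B) + emeasure lborel ({0..<r} \<inter> B)"
    using B by (subst (1 2) emeasure_lborel_translate) auto
  also have "\<dots> = emeasure lborel (({r..<1} \<inter> B) \<union> ({0..<r} \<inter> B))"
    using B by (intro plus_emeasure) auto
  also have "({r..<1} \<inter> B) \<union> ({0..<r} \<inter> B) = {0..<1} \<inter> B" using r by auto
  finally show ?thesis .
qed

lemma to_torus_eq_iff: "to_torus x = to_torus y \<longleftrightarrow> x - y \<in> int_vecs"
  by (rule torus.abs_eq_iff)

text \<open>The preimage in the vector space leaves coordinate \<open>i\<close> free and fixes the
  others modulo 1, so it is closed.\<close>

lemma circle_orbit_in_borel:
  "(\<lambda>u. to_torus x + to_torus u) ` coordinate_subspace {i} \<in> sets borel"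
  for x :: "real ^ 'm"
proof -
  let ?O = "(\<lambda>u. to_torus x + to_torus u) ` coordinate_subspace {i}"
  have "to_torus -` ?O = (\<Inter>j\<in>-{i}. {y. y $ j - x $ j \<in> \<int>})" (is "_ = ?R")
  proof
    show "to_torus -` ?O \<subseteq> ?R"
    proof
      fix y assume "y \<in> to_torus -` ?O"
      then obtain u where "u \<in> coordinate_subspace {i}" "y - (x + u) \<in> int_vecs"
        by (auto simp: torus_add to_torus_eq_iff)
      moreover from this have "(y - (x + u)) $ j = y $ j - x $ j" if "j \<noteq> i" for j
        using that by (simp add: coordinate_subspace_def)
      ultimately have "y $ j - x $ j \<in> \<int>" if "j \<noteq> i" for j
        using that unfolding int_vecs_def by (metis mem_Collect_eq)
      then show "y \<in> ?R" by simp
    qed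
    show "?R \<subseteq> to_torus -` ?O"
    proof
      fix y assume y: "y \<in> ?R"
      define u where "u = (y $ i - x $ i) *\<^sub>R axis i (1::real)"
      have "y $ j - (x + u) $ j \<in> \<int>" for j
        using y by (cases "j = i") (auto simp: u_def axis_def)
      then have "to_torus y = to_torus x + to_torus u"
        by (simp add: torus_add to_torus_eq_iff int_vecs_def)
      moreover have "u \<in> coordinate_subspace {i}" by (auto simp: u_def coordinate_subspace_def axis_def)
      ultimately show "y \<in> to_torus -` ?O" by blast
    qed
  qed
  moreover have "closed ?R"
  proof (intro closed_INT ballI)
    fix j
    have "closed ((\<lambda>y :: real ^ 'm. y $ j - x $ j) -` \<int>)"
      by (intro closed_vimage closed_Ints continuous_intros)
    then show "closed {y. y $ j - x $ j \<in> \<int>}" by (simp add: vimage_def)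
  qed
  ultimately have "open (- (to_torus -` ?O))" by (simp only: open_Compl)
  then have "closed ?O" unfolding closed_def open_torus_def vimage_Compl .
  then show ?thesis by (rule borel_closed)
qed

text \<open>The measure is Lebesgue measure on \<open>[0, 1)\<close> pushed forward along the line
  through \<open>x\<close> in direction \<open>i\<close>, which closes up to a circle.\<close>

lemma exists_circle_measure:
  fixes x :: "real ^ 'm" and i :: 'm
  assumes A: "A \<in> sets borel" and sub: "\<And>t. to_torus (x + t *\<^sub>R axis i 1) \<in> A"
  shows "\<exists>\<mu>. nontrivial_algebraic \<mu> \<and> emeasure \<mu> A = 1"
proof -
  define \<phi> where "\<phi> = (\<lambda>t. to_torus (x + t *\<^sub>R axis i (1::real)))"
  define \<mu> where "\<mu> = distr (uniform_measure lborel {0..<1}) borel \<phi>"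
  define U where "U = (coordinate_subspace {i} :: (real ^ 'm) set)"
  have "continuous_on UNIV \<phi>"
    unfolding \<phi>_def by (intro continuous_on_compose2[OF continuous_on_to_torus] continuous_intros) auto
  then have \<phi>: "\<phi> \<in> borel_measurable borel" by (rule borel_measurable_continuous_onI)
  have em: "emeasure \<mu> B = emeasure lborel ({0..<1} \<inter> \<phi> -` B)" if B: "B \<in> sets borel" for B
  proof -
    have "\<phi> -` B \<in> sets borel" using measurable_sets[OF \<phi> B] by simp
    then show ?thesis using \<phi> B
      by (simp add: \<mu>_def emeasure_distr divide_ennreal_def)
  qed
  have full: "emeasure \<mu> B = 1" if "B \<in> sets borel" "\<And>t. \<phi> t \<in> B" for B
  proof -
    have "\<phi> -` B = UNIV" using that(2) by auto
    then show ?thesis using em[OF that(1)] by simp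
  qed
  have "prob_space (uniform_measure lborel {0..<1::real})"
    by (intro prob_space_uniform_measure) auto
  then have prob: "prob_space \<mu>"
    unfolding \<mu>_def using \<phi> by (intro prob_space.prob_space_distr) auto
  have inv: "distr \<mu> borel (\<lambda>z. z + to_torus u) = \<mu>" if u: "u \<in> U" for u
  proof (rule measure_eqI)
    fix B assume "B \<in> sets (distr \<mu> borel (\<lambda>z. z + to_torus u))"
    then have B: "B \<in> sets borel" by simp
    have tr: "(\<lambda>z. z + to_torus u) \<in> borel_measurable borel"
      by (intro borel_measurable_continuous_onI continuous_on_torus_translate)
    have Btr: "(\<lambda>z. z + to_torus u) -` B \<in> sets borel" using measurable_sets[OF tr B] by simp
    have uu: "u = (u $ i) *\<^sub>R axis i 1"
      using u by (auto simp: U_def coordinate_subspace_def vec_eq_iff axis_def)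
    \<comment> \<open>Translation along the orbit becomes a shift of the parameter, which reduces
      invariance to the statement about periodic sets of reals.\<close>
    have "\<phi> t + to_torus u = \<phi> (t + u $ i)" for t
      unfolding \<phi>_def torus_add by (subst uu) (simp add: algebra_simps)
    then have eq: "\<phi> -` ((\<lambda>z. z + to_torus u) -` B) = {t. t + u $ i \<in> \<phi> -` B}" by auto
    have periodic: "t + real_of_int k \<in> \<phi> -` B \<longleftrightarrow> t \<in> \<phi> -` B" for t k
    proof -
      have "\<phi> (t + real_of_int k) = \<phi> t"
        unfolding \<phi>_def to_torus_eq_iff by (simp add: int_vecs_def axis_def algebra_simps)
      then show ?thesis by simp
    qed
    have "emeasure (distr \<mu> borel (\<lambda>z. z + to_torus u)) B = emeasure \<mu> ((\<lambda>z. z + to_torus u) -` B)"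
      using tr B by (subst emeasure_distr) (auto simp: \<mu>_def)
    also have "\<dots> = emeasure lborel ({0..<1} \<inter> {t. t + u $ i \<in> \<phi> -` B})"
      unfolding em[OF Btr] eq ..
    also have "\<dots> = emeasure \<mu> B"
      unfolding em[OF B] using measurable_sets[OF \<phi> B] periodic
      by (intro emeasure_lborel_periodic_translate) auto
    finally show "emeasure (distr \<mu> borel (\<lambda>z. z + to_torus u)) B = emeasure \<mu> B" .
  qed (simp add: \<mu>_def)
  have "\<phi> t \<in> (\<lambda>u. to_torus x + to_torus u) ` U" for t
    unfolding \<phi>_def U_def
    by (intro image_eqI[of _ _ "t *\<^sub>R axis i 1"]) (auto simp: torus_add coordinate_subspace_def axis_def)
  then have "emeasure \<mu> ((\<lambda>u. to_torus x + to_torus u) ` U) = 1"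
    using circle_orbit_in_borel[of x i] by (intro full) (auto simp: U_def)
  then have "algebraic_wrt U \<mu>"
    using prob inv rational_subspace_coordinate_subspace[of "{i}"]
    by (auto simp: algebraic_wrt_def \<mu>_def U_def)
  moreover have "axis i 1 \<in> U" by (auto simp: U_def coordinate_subspace_def axis_def)
  then have "U \<noteq> {0}" by (auto simp: axis_eq_0_iff)
  ultimately show ?thesis
    using full[OF A] sub unfolding nontrivial_algebraic_def \<phi>_def by blast
qed


section \<open>From coordinate estimates to the theorem\<close>

lemma le_powr_inverse_if_power_le:
  fixes x y :: real
  assumes "0 \<le> x" "x ^ m \<le> y" "m > 0"
  shows "x \<le> y powr (1 / m)"
proof (cases "x = 0")
  case False
  then have "x = (x ^ m) powr (1 / m)"
    using assms by (simp add: powr_powr flip: powr_realpow)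
  also have "\<dots> \<le> y powr (1 / m)" using assms by (intro powr_mono2) auto
  finally show ?thesis .
qed simp

text \<open>A crude \<open>m\<close>-th root: \<open>4 \<le> 4 ^ m\<close> allows the factor 1/4 to
  be kept outside the root.\<close>

lemma quarter_le_powr_inverse:
  fixes y :: real
  assumes "real n ^ m / 4 \<le> y" "m > 0"
  shows "n / 4 \<le> y powr (1 / m)"
proof (rule le_powr_inverse_if_power_le)
  have "(4::real) ^ 1 \<le> 4 ^ m" using assms(2) by (intro power_increasing) auto
  then have "real n ^ m / 4 ^ m \<le> real n ^ m / 4" by (intro divide_left_mono) auto
  also note assms(1)
  finally show "(real n / 4) ^ m \<le> y" by (simp add: power_divide)
qed (use assms in auto)

lemma mem_Bad:
  fixes \<theta> y :: "real ^ 'm"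
  assumes "c > 0"
    and "\<And>q :: int. q \<noteq> 0 \<Longrightarrow> c \<le> real_of_int \<bar>q\<bar> powr (1 / CARD('m)) * dist_int N (real_of_int q *\<^sub>R \<theta> - y)"
  shows "to_torus y \<in> Bad N \<theta>"
proof -
  obtain j where "1 / Suc j < c" using assms(1) reals_Archimedean[of c] by (auto simp: inverse_eq_divide)
  then have "1 / Suc j \<le> real_of_int \<bar>q\<bar> powr (1 / CARD('m)) *
      torus_dist0 N (to_torus (real_of_int q *\<^sub>R \<theta>) - to_torus y)" if "\<bar>q\<bar> \<ge> 1" for q
    using assms(2)[of q] that unfolding torus_diff torus_dist0_to_torus by fastforce
  then show ?thesis unfolding Bad_iff by blast
qed

text \<open>The constant \<open>c\<close> is uniform in \<open>y\<close> because the estimates away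
  from 1/2 involve only the coordinates \<open>b 1\<close> and \<open>b 2\<close>.\<close>

lemma exists_nonsingular_avoiding_codim_2:
  fixes N :: "real ^ 'm \<Rightarrow> real" and b :: "nat \<Rightarrow> 'm"
  assumes N: "is_norm N" and m: "CARD('m) > 2" and b: "bij_betw b {1..CARD('m)} UNIV"
  shows "\<exists>(\<theta> :: real ^ 'm) c. \<not> singular N \<theta> \<and> c > 0 \<and>
    (\<forall>(y :: real ^ 'm) (q :: int). y $ b 1 = 1 / 2 \<longrightarrow> y $ b 2 = 1 / 2 \<longrightarrow> q \<noteq> 0 \<longrightarrow>
       c \<le> real_of_int \<bar>q\<bar> powr (1 / CARD('m)) * dist_int N (real_of_int q *\<^sub>R \<theta> - y))"
proof -
  define m where "m = CARD('m)"
  have m3: "m \<ge> 3" using m by (simp add: m_def)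
  have inj: "b i = b j \<longleftrightarrow> i = j" if "i \<in> {1..m}" "j \<in> {1..m}" for i j
    using b that unfolding m_def bij_betw_def inj_on_def by blast
  define c where "c k = (if even k then b 1 else b 2)" for k :: nat
  \<comment> \<open>The weight of \<open>b j\<close> is \<open>j - 1\<close>, except that
    \<open>b 1\<close> is raised to weight 1 and so shares it with \<open>b 2\<close>.\<close>
  define w where "w i = max 1 (inv_into {1..m} b i - 1)" for i
  have w_b: "w (b j) = max 1 (j - 1)" if "j \<in> {1..m}" for j
    using b that unfolding w_def m_def by (simp add: bij_betw_inv_into_left)
  interpret alternating_coordinates c w m
  proof
    show "2 \<le> m" using m3 by simp
    show c_Suc: "c (Suc k) \<noteq> c k" for k using m3 by (simp add: c_def inj)
    show w_c: "w (c k) = 1" for k using m3 by (simp add: c_def w_b)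
    show "1 \<le> w i" for i by (simp add: w_def)
    show "\<exists>i\<in>- {c k}. w i = e" if e: "e \<in> {1..m - 1}" for k e
    proof (cases "e = 1")
      case True
      then show ?thesis using c_Suc w_c by (intro bexI[of _ "c (Suc k)"]) auto
    next
      case False
      then show ?thesis using e m3 by (intro bexI[of _ "b (Suc e)"]) (auto simp: w_b c_def inj)
    qed
  qed
  obtain t :: "'m \<Rightarrow> real" and n :: "nat \<Rightarrow> nat" where mono: "strict_mono n" and n0: "n 0 = 3"
    and nonsing: "\<forall>k q. q \<noteq> 0 \<longrightarrow> 4 * \<bar>real_of_int q\<bar> \<le> n (Suc k) ^ m \<longrightarrow>
        (\<exists>i. \<forall>z :: int. 1 / (4 * n (Suc k)) \<le> \<bar>q * t i - z\<bar>)"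
    and away: "\<forall>k q. 4 * \<bar>real_of_int q\<bar> \<le> n (Suc k) ^ m \<longrightarrow>
        (\<forall>z :: int. 1 / (8 * n k) \<le> \<bar>q * t (c k) - 1 / 2 - z\<bar>)"
    using exists_nonsingular_avoiding_half by (elim exE conjE)
  obtain \<kappa> where \<kappa>: "\<kappa> > 0" "\<And>z i r. (\<And>p :: int. r \<le> \<bar>z $ i - p\<bar>) \<Longrightarrow> \<kappa> * r \<le> dist_int N z"
    using dist_int_ge[OF N] by blast
  define \<theta> :: "real ^ 'm" where "\<theta> = (\<chi> i. t i)"
  have n_pos: "n k > 0" for k
    using strict_mono_mono[OF mono] n0 by (metis monoD le0 not_gr_zero le_zero_eq zero_neq_numeral)
  have large: "\<exists>k. C \<le> real (n (Suc k) ^ m)" for C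
  proof -
    obtain k where "C \<le> real k" using real_arch_simple by blast
    also have "k \<le> n (Suc k)" using seq_suble[OF mono, of "Suc k"] by simp
    also have "n (Suc k) \<le> n (Suc k) ^ m" using n_pos[of "Suc k"] m3 by (intro self_le_power) auto
    finally show ?thesis by (intro exI[of _ k]) simp
  qed
  have "\<not> singular N \<theta>"
  proof
    assume "singular N \<theta>"
    then have "\<forall>\<^sub>F Q :: real in at_top. Q powr (1 / m) *
        Min ((\<lambda>q. dist_int N (real_of_int q *\<^sub>R \<theta>)) ` {q :: int. q \<noteq> 0 \<and> real_of_int \<bar>q\<bar> \<le> Q}) < \<kappa> / 16"
      \<comment> \<open>The threshold is the product of the lower bounds \<open>n / 4\<close> for
        the root of \<open>Q\<close> and \<open>\<kappa> / (4 * n)\<close> for the distance, where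
        \<open>n\<close> is \<open>n (Suc k)\<close>.\<close>
      using \<kappa>(1) unfolding singular_def m_def by (elim allE[of _ "\<kappa> / 16"]) simp
    then obtain Q0 where Q0: "\<And>Q. Q \<ge> Q0 \<Longrightarrow> Q powr (1 / m) *
        Min ((\<lambda>q. dist_int N (real_of_int q *\<^sub>R \<theta>)) ` {q :: int. q \<noteq> 0 \<and> real_of_int \<bar>q\<bar> \<le> Q}) < \<kappa> / 16"
      unfolding eventually_at_top_linorder by blast
    obtain k where k: "4 * max 1 Q0 \<le> real (n (Suc k) ^ m)" using large by blast
    \<comment> \<open>The largest \<open>Q\<close> for which every admissible \<open>q\<close> falls
      under \<open>nonsing\<close> at stage \<open>k\<close>.\<close>
    define Q where "Q = real (n (Suc k)) ^ m / 4"
    let ?A = "{q :: int. q \<noteq> 0 \<and> real_of_int \<bar>q\<bar> \<le> Q}"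
    have Q: "Q \<ge> Q0" "Q \<ge> 1" using k by (auto simp: Q_def)
    have "?A \<subseteq> {-\<lfloor>Q\<rfloor>..\<lfloor>Q\<rfloor>}" by (auto simp: le_floor_iff minus_le_iff)
    then have "finite ?A" by (rule finite_subset) simp
    moreover have "1 \<in> ?A" using Q by simp
    ultimately have "Min ((\<lambda>q. dist_int N (real_of_int q *\<^sub>R \<theta>)) ` ?A)
        \<in> (\<lambda>q. dist_int N (real_of_int q *\<^sub>R \<theta>)) ` ?A" by (intro Min_in finite_imageI) blast+
    then obtain q where q: "q \<in> ?A"
      and Min: "Min ((\<lambda>q. dist_int N (real_of_int q *\<^sub>R \<theta>)) ` ?A) = dist_int N (real_of_int q *\<^sub>R \<theta>)"
      by blast
    obtain i where i: "\<And>z :: int. 1 / (4 * n (Suc k)) \<le> \<bar>q * t i - z\<bar>"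
      using nonsing[rule_format, of q k] q by (auto simp: Q_def)
    have "\<kappa> * (1 / (4 * n (Suc k))) \<le> dist_int N (real_of_int q *\<^sub>R \<theta>)"
      using i by (intro \<kappa>(2)[where i = i]) (simp add: \<theta>_def)
    moreover have "n (Suc k) / 4 \<le> Q powr (1 / m)"
      using m3 by (intro quarter_le_powr_inverse) (auto simp: Q_def)
    ultimately have "(n (Suc k) / 4) * (\<kappa> * (1 / (4 * n (Suc k)))) \<le>
        Q powr (1 / m) * dist_int N (real_of_int q *\<^sub>R \<theta>)"
      using \<kappa>(1) by (intro mult_mono) auto
    moreover have "(n (Suc k) / 4) * (\<kappa> * (1 / (4 * n (Suc k)))) = \<kappa> / 16"
      using n_pos[of "Suc k"] by simp
    ultimately show False using Q0[OF Q(1), unfolded Min] by linarith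
  qed
  moreover have "\<kappa> / 32 \<le> real_of_int \<bar>q\<bar> powr (1 / m) * dist_int N (real_of_int q *\<^sub>R \<theta> - y)"
    if y: "y $ b 1 = 1 / 2" "y $ b 2 = 1 / 2" and q0: "q \<noteq> 0" for y and q :: int
  proof -
    \<comment> \<open>At the first stage whose range contains \<open>q\<close>, minimality gives
      \<open>4 * \<bar>q\<bar> > n k ^ m\<close> when \<open>k > 0\<close>, which matches the bound
      \<open>1 / (8 * n k)\<close>.\<close>
    define k where "k = (LEAST k. 4 * \<bar>real_of_int q\<bar> \<le> real (n (Suc k) ^ m))"
    have k: "4 * \<bar>real_of_int q\<bar> \<le> real (n (Suc k) ^ m)"
      unfolding k_def using large[of "4 * \<bar>real_of_int q\<bar>"] by (rule LeastI_ex)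
    have "y $ c k = 1 / 2" using y by (simp add: c_def)
    then have "(real_of_int q *\<^sub>R \<theta> - y) $ c k = q * t (c k) - 1 / 2" by (simp add: \<theta>_def)
    then have dist: "\<kappa> * (1 / (8 * n k)) \<le> dist_int N (real_of_int q *\<^sub>R \<theta> - y)"
      using away[rule_format, OF k] by (intro \<kappa>(2)[where i = "c k"]) simp
    have "n k / 4 \<le> real_of_int \<bar>q\<bar> powr (1 / m)"
    proof (cases k)
      case 0
      \<comment> \<open>No earlier stage bounds \<open>q\<close> from below here;
        \<open>n 0 / 4 = 3 / 4\<close> is already less than 1.\<close>
      have "1 \<le> real_of_int \<bar>q\<bar> powr (1 / m)" using q0 by (intro ge_one_powr_ge_zero) auto
      then show ?thesis by (simp add: 0 n0)
    next
      case (Suc l)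
      then have "\<not> 4 * \<bar>real_of_int q\<bar> \<le> real (n (Suc l) ^ m)"
        unfolding k_def by (metis lessI not_less_Least)
      then show ?thesis using m3 by (intro quarter_le_powr_inverse) (auto simp: Suc)
    qed
    then have "(n k / 4) * (\<kappa> * (1 / (8 * n k))) \<le>
        real_of_int \<bar>q\<bar> powr (1 / m) * dist_int N (real_of_int q *\<^sub>R \<theta> - y)"
      using dist \<kappa>(1) by (intro mult_mono) auto
    moreover have "(n k / 4) * (\<kappa> * (1 / (8 * n k))) = \<kappa> / 32" using n_pos[of k] by simp
    ultimately show ?thesis by simp
  qed
  ultimately show ?thesis
    using \<kappa>(1) unfolding m_def by (intro exI[of _ \<theta>] exI[of _ "\<kappa> / 32"]) auto
qed

theorem theorem1p7:
  fixes N :: "real ^ 'm \<Rightarrow> real"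
    and b :: "nat \<Rightarrow> 'm"
  assumes "is_norm N"
    and "CARD('m) > 2"
    and "bij_betw b {1..CARD('m)} UNIV"
  shows "\<exists>\<theta> :: real ^ 'm.
           \<not> singular N \<theta> \<and>
           (\<exists>\<eta> :: real ^ 'm. \<forall>t :: nat \<Rightarrow> real.
              (INF q\<in>UNIV - {0 :: int}.
                 real_of_int \<bar>q\<bar> powr (1 / CARD('m)) *
                 dist_int N (real_of_int q *\<^sub>R \<theta> -
                   (\<eta> + (\<Sum>j = 3..CARD('m). t j *\<^sub>R axis (b j) 1)))) > 0) \<and>
           (\<exists>S x. subtorus_codim 2 S \<and> (\<lambda>s. x + s) ` S \<subseteq> Bad N \<theta>) \<and>
           (\<exists>\<mu>. nontrivial_algebraic \<mu> \<and> emeasure \<mu> (Bad N \<theta>) = 1)"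
proof -
  obtain \<theta> :: "real ^ 'm" and c where nonsing: "\<not> singular N \<theta>" and c: "c > 0"
    and far: "\<And>(y :: real ^ 'm) q :: int. y $ b 1 = 1 / 2 \<Longrightarrow> y $ b 2 = 1 / 2 \<Longrightarrow> q \<noteq> 0 \<Longrightarrow>
       c \<le> real_of_int \<bar>q\<bar> powr (1 / CARD('m)) * dist_int N (real_of_int q *\<^sub>R \<theta> - y)"
    using exists_nonsingular_avoiding_codim_2[OF assms] by blast
  have inj: "b i = b j \<longleftrightarrow> i = j" if "i \<in> {1..CARD('m)}" "j \<in> {1..CARD('m)}" for i j
    using assms(3) that unfolding bij_betw_def inj_on_def by blast
  define \<eta> :: "real ^ 'm" where "\<eta> = (\<chi> i. 1 / 2)"
  have bad: "to_torus y \<in> Bad N \<theta>" if "y $ b 1 = 1 / 2" "y $ b 2 = 1 / 2" for y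
    using mem_Bad[OF c far[OF that]] .
  have "(INF q\<in>UNIV - {0 :: int}. real_of_int \<bar>q\<bar> powr (1 / CARD('m)) *
      dist_int N (real_of_int q *\<^sub>R \<theta> - (\<eta> + (\<Sum>j = 3..CARD('m). t j *\<^sub>R axis (b j) 1)))) > 0"
    (is "Inf (?f ` _) > 0") for t
  proof -
    have half: "(\<eta> + (\<Sum>j = 3..CARD('m). t j *\<^sub>R axis (b j) 1)) $ b l = 1 / 2" if "l \<in> {1, 2}" for l
    proof -
      \<comment> \<open>The free directions start at index 3, so the coordinates \<open>b 1\<close>
        and \<open>b 2\<close> keep the value 1/2.\<close>
      have "(\<Sum>j = 3..CARD('m). t j * axis (b j) 1 $ b l) = 0"
        using that assms(2) by (intro sum.neutral) (auto simp: axis_def inj)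
      then show ?thesis by (simp add: \<eta>_def)
    qed
    have le: "c \<le> ?f q" if "q \<noteq> 0" for q
      using half[of 1] half[of 2] that by (intro far) simp_all
    have "c \<le> (INF q\<in>UNIV - {0 :: int}. ?f q)"
    proof (rule cINF_greatest)
      have "(1 :: int) \<in> UNIV - {0}" by simp
      then show "UNIV - {0 :: int} \<noteq> {}" by blast
      show "c \<le> ?f q" if "q \<in> UNIV - {0}" for q using that by (intro le) simp
    qed
    with c show ?thesis by linarith
  qed
  moreover have "\<exists>S x. subtorus_codim 2 S \<and> (\<lambda>s. x + s) ` S \<subseteq> Bad N \<theta>"
  proof (intro exI conjI)
    let ?U = "coordinate_subspace (- {b 1, b 2})"
    have "card {b 1, b 2} = 2" using assms(2) by (simp add: inj)
    then have "card (- {b 1, b 2}) + 2 = CARD('m)"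
      using assms(2) card_Diff_subset[of "{b 1, b 2}" UNIV] by (simp add: Compl_eq_Diff_UNIV)
    then show "subtorus_codim 2 (to_torus ` ?U)"
      unfolding subtorus_codim_def
      by (intro exI[of _ ?U]) (simp add: rational_subspace_coordinate_subspace dim_coordinate_subspace)
    show "(\<lambda>s. to_torus \<eta> + s) ` to_torus ` ?U \<subseteq> Bad N \<theta>"
      by (auto simp: torus_add \<eta>_def coordinate_subspace_def intro!: bad)
  qed
  moreover have "\<exists>\<mu>. nontrivial_algebraic \<mu> \<and> emeasure \<mu> (Bad N \<theta>) = 1"
  proof (rule exists_circle_measure[OF Bad_in_borel[OF assms(1)]])
    \<comment> \<open>Dimension greater than 2 provides the direction \<open>b 3\<close>, and the
      whole circle along it stays in the bad coset.\<close>
    show "to_torus (\<eta> + t *\<^sub>R axis (b 3) 1) \<in> Bad N \<theta>" for t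
      using assms(2) by (intro bad) (auto simp: \<eta>_def axis_def inj)
  qed
  ultimately show ?thesis using nonsing by blast
qed

end
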